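(* Let $\mathbf{A}$ be a finite Boolean algebra with $k+1$ atoms $a_0,\dots,a_k$ (so $|A|=2^{k+1}$) and let $m$ be the finitely additive probability measure on $\mathbf{A}$ such that $m(a_i)=\frac{1}{k+1}$ for every atom $a_i$ of $\mathbf{A}$. Then the metric space $(\mathsf{At}(\mathbf{A}),d_m)$ embeds isometrically in $\mathbb{R}^k$ with the Euclidean metric.
   Context: A finitely additive probability measure on a Boolean algebra $\mathbf{A}$ is a map $m\colon\mathbf{A}\to[0,1]$ with $m(\top)=1$ and $m(a\vee b)=m(a)+m(b)$ whenever $a\wedge b=\perp$; it is strictly positive if $m(a)>0$ for all $a\neq\perp$. A strictly positive $m$ induces the metric $d_m(a,b)=m((a\wedge b')\vee(a'\wedge b))$ on $\mathbf{A}$, where $'$ is complementation. $\mathsf{At}(\mathbf{A})$ denotes the set of atoms of $\mathbf{A}$ with the restriction of $d_m$. *)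

theory Defs
  imports "HOL-Analysis.Analysis"
begin

unbundle lattice_syntax

definition atoms :: "'a::boolean_algebra set" where
  "atoms = {a. a \<noteq> \<bottom> \<and> (\<forall>b. b \<le> a \<longrightarrow> b = \<bottom> \<or> b = a)}"

definition fin_add_prob :: "('a::boolean_algebra \<Rightarrow> real) \<Rightarrow> bool" where
  "fin_add_prob m \<longleftrightarrow>
     (\<forall>a. m a \<in> {0..1}) \<and> m \<top> = 1 \<and>
     (\<forall>a b. a \<sqinter> b = \<bottom> \<longrightarrow> m (a \<squnion> b) = m a + m b)"

definition strictly_positive :: "('a::boolean_algebra \<Rightarrow> real) \<Rightarrow> bool" where
  "strictly_positive m \<longleftrightarrow> (\<forall>a. a \<noteq> \<bottom> \<longrightarrow> m a > 0)"

definition meas_dist :: "('a::boolean_algebra \<Rightarrow> real) \<Rightarrow> 'a \<Rightarrow> 'a \<Rightarrow> real" where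
  "meas_dist m a b = m ((a \<sqinter> - b) \<squnion> (- a \<sqinter> b))"

text \<open>
  The space \<open>\<real>\<^sup>k\<close> for a natural number \<open>k\<close>, with \<open>k = 0\<close> allowed (which rules out the
  types \<open>real ^ 'n\<close>): real sequences vanishing from index \<open>k\<close> on. This is the
  carrier of the library's topological space \<^const>\<open>Euclidean_space\<close>.
\<close>

definition Rn :: "nat \<Rightarrow> (nat \<Rightarrow> real) set" where
  "Rn k = {x. \<forall>i\<ge>k. x i = 0}"

definition Rn_dist :: "nat \<Rightarrow> (nat \<Rightarrow> real) \<Rightarrow> (nat \<Rightarrow> real) \<Rightarrow> real" where
  "Rn_dist k x y = sqrt (\<Sum>i<k. (x i - y i)\<^sup>2)"

definition isometric_embedding ::
  "'a set \<Rightarrow> ('a \<Rightarrow> 'a \<Rightarrow> real) \<Rightarrow> 'b set \<Rightarrow> ('b \<Rightarrow> 'b \<Rightarrow> real) \<Rightarrow> ('a \<Rightarrow> 'b) \<Rightarrow> bool" where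
  "isometric_embedding M d N e f \<longleftrightarrow>
     f \<in> M \<rightarrow> N \<and> (\<forall>x\<in>M. \<forall>y\<in>M. e (f x) (f y) = d x y)"

lemma topspace_Euclidean_space_eq_Rn: "topspace (Euclidean_space k) = Rn k"
  by (simp add: topspace_Euclidean_space Rn_def)

lemma Metric_space_Rn: "Metric_space (Rn k) (Rn_dist k)"
proof
  fix x y z :: "nat \<Rightarrow> real"
  show "0 \<le> Rn_dist k x y"
    by (simp add: Rn_dist_def sum_nonneg)
  show "Rn_dist k x y = Rn_dist k y x"
    by (simp add: Rn_dist_def power2_commute)
  show "(Rn_dist k x y = 0) = (x = y)" if "x \<in> Rn k" "y \<in> Rn k"
  proof -
    have "Rn_dist k x y = 0 \<longleftrightarrow> (\<forall>i<k. x i = y i)"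
      by (auto simp: Rn_dist_def sum_nonneg_eq_0_iff)
    also have "\<dots> \<longleftrightarrow> x = y"
      using that unfolding Rn_def fun_eq_iff by (metis (mono_tags) mem_Collect_eq not_le)
    finally show ?thesis .
  qed
  show "Rn_dist k x z \<le> Rn_dist k x y + Rn_dist k y z"
    using L2_set_triangle_ineq[of "\<lambda>i. x i - y i" "\<lambda>i. y i - z i" "{..<k}"]
    by (simp add: Rn_dist_def L2_set_def)
qed

lemma fin_add_prob_mono:
  assumes "fin_add_prob m" "a \<le> b" shows "m a \<le> m b"
proof -
  have "a \<sqinter> (b \<sqinter> - a) = \<bottom>"
    by (simp add: inf_left_commute)
  then have "m (a \<squnion> (b \<sqinter> - a)) = m a + m (b \<sqinter> - a)" "0 \<le> m (b \<sqinter> - a)"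
    using assms(1) unfolding fin_add_prob_def by auto
  moreover have "a \<squnion> (b \<sqinter> - a) = b"
    using assms(2) by (simp add: sup_inf_distrib1 sup_absorb2)
  ultimately show ?thesis by simp
qed

lemma fin_add_prob_subadd:
  assumes "fin_add_prob m" shows "m (a \<squnion> b) \<le> m a + m b"
proof -
  have "a \<sqinter> (b \<sqinter> - a) = \<bottom>"
    by (simp add: inf_left_commute)
  then have "m (a \<squnion> (b \<sqinter> - a)) = m a + m (b \<sqinter> - a)"
    using assms unfolding fin_add_prob_def by auto
  moreover have "a \<squnion> (b \<sqinter> - a) = a \<squnion> b"
    by (simp add: sup_inf_distrib1)
  moreover have "m (b \<sqinter> - a) \<le> m b"
    using assms by (simp add: fin_add_prob_mono)
  ultimately show ?thesis by simp
qed

lemma Metric_space_meas_dist: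
  assumes "fin_add_prob m" "strictly_positive m"
  shows "Metric_space M (meas_dist m)"
proof
  fix a b c :: 'a
  show "0 \<le> meas_dist m a b"
    using assms(1) by (auto simp: meas_dist_def fin_add_prob_def)
  show "meas_dist m a b = meas_dist m b a"
    by (simp add: meas_dist_def sup_commute inf_commute)
  have m_bot: "m \<bottom> = 0"
    using assms(1) unfolding fin_add_prob_def by (metis add_cancel_right_right inf.idem sup.idem)
  show "(meas_dist m a b = 0) = (a = b)"
  proof
    assume "meas_dist m a b = 0"
    then have "(a \<sqinter> - b) \<squnion> (- a \<sqinter> b) = \<bottom>"
      using assms(2) unfolding meas_dist_def strictly_positive_def by (metis less_irrefl)
    then have "a \<sqinter> - b = \<bottom>" "b \<sqinter> - a = \<bottom>"
      by (simp_all add: inf_commute)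
    then show "a = b"
      by (metis antisym inf_shunt double_compl)
  qed (simp add: meas_dist_def m_bot)
  have "a \<sqinter> - c = (a \<sqinter> - c \<sqinter> b) \<squnion> (a \<sqinter> - c \<sqinter> - b)"
    by (metis inf_sup_distrib1 inf_top_right sup_compl_top)
  moreover have "- a \<sqinter> c = (- a \<sqinter> c \<sqinter> b) \<squnion> (- a \<sqinter> c \<sqinter> - b)"
    by (metis inf_sup_distrib1 inf_top_right sup_compl_top)
  moreover have "a \<sqinter> - c \<sqinter> b \<le> b \<sqinter> - c" "a \<sqinter> - c \<sqinter> - b \<le> a \<sqinter> - b"
    "- a \<sqinter> c \<sqinter> b \<le> - a \<sqinter> b" "- a \<sqinter> c \<sqinter> - b \<le> - b \<sqinter> c"
    by (simp_all add: le_infI1 le_infI2)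
  ultimately have "(a \<sqinter> - c) \<squnion> (- a \<sqinter> c)
      \<le> ((a \<sqinter> - b) \<squnion> (- a \<sqinter> b)) \<squnion> ((b \<sqinter> - c) \<squnion> (- b \<sqinter> c))"
    by (smt (verit) le_supI le_supI1 le_supI2)
  then show "meas_dist m a c \<le> meas_dist m a b + meas_dist m b c"
    unfolding meas_dist_def
    by (meson assms(1) fin_add_prob_mono fin_add_prob_subadd order_trans)
qed

end

theory Submission
  imports Defs
begin

text \<open>
  Two distinct atoms \<open>a\<close>, \<open>b\<close> are disjoint, so their symmetric difference is \<open>a \<squnion> b\<close>, of
  measure \<open>m a + m b\<close>. If all atoms have the same measure, any two distinct atoms are therefore at
  the same distance \<open>2 / (k + 1)\<close>: the \<open>k + 1\<close> atoms form an equilateral space. Such a space is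
  the vertex set of a regular simplex, and a regular simplex with \<open>k + 1\<close> vertices and prescribed
  edge length exists in \<open>\<real>\<^sup>k\<close> (lemma \<open>regular_simplex_exists\<close>).

  For the simplex one could take the \<open>k + 1\<close> unit vectors of \<open>\<real>\<^sup>k\<^sup>+\<^sup>1\<close>, which are pairwise at
  distance \<open>sqrt 2\<close>, but they lie in an affine hyperplane that would have to be identified with
  \<open>\<real>\<^sup>k\<close>. It is simpler to take the \<open>k\<close> unit vectors of \<open>\<real>\<^sup>k\<close> and to find the last vertex by
  symmetry on the diagonal, at a point \<open>(t, \<dots>, t)\<close>. Its squared distance to a unit vector is
  \<open>(1 - t)\<^sup>2 + (k - 1) t\<^sup>2\<close>, and this is \<open>2\<close> iff \<open>k t\<^sup>2 - 2 t = 1\<close>. The negative root,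
  written as \<open>t = - 1 / (1 + sqrt (k + 1))\<close>, makes sense for \<open>k = 0\<close> too, so that case is not
  special.
\<close>

lemma atoms_disjoint:
  assumes "a \<in> atoms" "b \<in> atoms" "a \<noteq> b"
  shows "a \<sqinter> b = \<bottom>"
proof (rule ccontr)
  assume ne: "a \<sqinter> b \<noteq> \<bottom>"
  have "c = \<bottom> \<or> c = a" if "c \<le> a" for c
    using assms(1) that unfolding atoms_def by blast
  then have "a \<sqinter> b = a"
    using ne inf_le1 by blast
  moreover have "c = \<bottom> \<or> c = b" if "c \<le> b" for c
    using assms(2) that unfolding atoms_def by blast
  then have "a \<sqinter> b = b"
    using ne inf_le2 by blast
  ultimately show False using assms(3) by simp
qed

lemma meas_dist_disjoint:
  assumes "fin_add_prob m" "a \<sqinter> b = \<bottom>"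
  shows "meas_dist m a b = m a + m b"
proof -
  have "a \<le> - b" "b \<le> - a"
    using assms(2) by (simp_all add: inf_shunt[symmetric] inf_commute)
  then have "a \<sqinter> - b = a" "- a \<sqinter> b = b"
    using inf_absorb1 inf_absorb2 by blast+
  then show ?thesis
    using assms by (simp add: meas_dist_def fin_add_prob_def)
qed

lemma meas_dist_self:
  assumes "fin_add_prob m"
  shows "meas_dist m a a = 0"
proof -
  have "m (\<bottom> \<squnion> \<bottom>) = m \<bottom> + m \<bottom>"
    using assms unfolding fin_add_prob_def by (metis inf.idem)
  then show ?thesis by (simp add: meas_dist_def)
qed

definition simplex_apex :: "nat \<Rightarrow> real" where
  "simplex_apex k = - 1 / (1 + sqrt (real k + 1))"

definition simplex_vertex :: "nat \<Rightarrow> nat \<Rightarrow> nat \<Rightarrow> real" where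
  "simplex_vertex k j i =
     (if i < k then if j < k then of_bool (i = j) else simplex_apex k else 0)"

lemma simplex_apex_quadratic: "real k * (simplex_apex k)\<^sup>2 - 2 * simplex_apex k = 1"
proof -
  define s where "s = sqrt (real k + 1)"
  have "s \<ge> 0" and k: "real k = s\<^sup>2 - 1"
    by (simp_all add: s_def)
  then have "1 + s \<noteq> 0" by linarith
  then have "(s\<^sup>2 - 1) * (- 1 / (1 + s))\<^sup>2 - 2 * (- 1 / (1 + s)) = 1"
    by (simp add: divide_simps) (simp add: algebra_simps power2_eq_square)
  then show ?thesis
    unfolding simplex_apex_def s_def[symmetric] by (simp only: k)
qed

text \<open>
  The coordinates of a unit vector \<open>e\<^sub>j\<close> are their own squares, and \<open>e\<^sub>j\<close> and \<open>e\<^sub>l\<close> have disjoint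
  supports. So each squared coordinate difference expands to an expression linear in unit vector
  coordinates, whose sum collapses: \<open>(e\<^sub>j - e\<^sub>l)\<^sup>2 = e\<^sub>j + e\<^sub>l\<close> between two unit vectors and
  \<open>(e\<^sub>j - t)\<^sup>2 = (1 - 2 t) e\<^sub>j + t\<^sup>2\<close> between a unit vector and the apex.
\<close>

lemma simplex_vertex_unit_unit:
  assumes "j < k" "l < k" "j \<noteq> l"
  shows "(\<Sum>i<k. (simplex_vertex k j i - simplex_vertex k l i)\<^sup>2) = 2"
proof -
  have "(\<Sum>i<k. (simplex_vertex k j i - simplex_vertex k l i)\<^sup>2)
      = (\<Sum>i<k. (if i = j then 1 else 0) + (if i = l then 1 else 0))"
    by (rule sum.cong) (use assms in \<open>auto simp: simplex_vertex_def\<close>)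
  also have "\<dots> = 2"
    using assms by (simp add: sum.distrib)
  finally show ?thesis .
qed

lemma simplex_vertex_unit_apex:
  assumes "j < k"
  shows "(\<Sum>i<k. (simplex_vertex k j i - simplex_vertex k k i)\<^sup>2) = 2"
proof -
  let ?t = "simplex_apex k"
  have "(\<Sum>i<k. (simplex_vertex k j i - simplex_vertex k k i)\<^sup>2)
      = (\<Sum>i<k. (if i = j then 1 - 2 * ?t else 0) + ?t\<^sup>2)"
    by (rule sum.cong) (use assms in \<open>auto simp: simplex_vertex_def power2_diff\<close>)
  also have "\<dots> = 1 - 2 * ?t + real k * ?t\<^sup>2"
    using assms by (simp add: sum.distrib)
  also have "\<dots> = 2"
    using simplex_apex_quadratic[of k] by simp
  finally show ?thesis .
qed

lemma simplex_vertex_sum_squares: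
  assumes "j \<le> k" "l \<le> k" "j \<noteq> l"
  shows "(\<Sum>i<k. (simplex_vertex k j i - simplex_vertex k l i)\<^sup>2) = 2"
proof -
  consider "j < k" "l < k" | "j < k" "l = k" | "l < k" "j = k"
    using assms by linarith
  then show ?thesis
  proof cases
    case 1
    then show ?thesis using assms(3) by (rule simplex_vertex_unit_unit)
  next
    case 2
    then show ?thesis using simplex_vertex_unit_apex by simp
  next
    case 3
    then show ?thesis
      using simplex_vertex_unit_apex[of l k] by (simp add: power2_commute)
  qed
qed

lemma regular_simplex_exists:
  fixes d :: real
  assumes "d \<ge> 0"
  obtains v where "\<And>j. v j \<in> Rn k"
    and "\<And>j l. j \<le> k \<Longrightarrow> l \<le> k \<Longrightarrow> Rn_dist k (v j) (v l) = (if j = l then 0 else d)"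
proof
  define v where "v j i = d / sqrt 2 * simplex_vertex k j i" for j i
  show "v j \<in> Rn k" for j
    by (simp add: v_def Rn_def simplex_vertex_def)
  show "Rn_dist k (v j) (v l) = (if j = l then 0 else d)" if "j \<le> k" "l \<le> k" for j l
  proof (cases "j = l")
    case True
    then show ?thesis by (simp add: Rn_dist_def)
  next
    case False
    have "(\<Sum>i<k. (v j i - v l i)\<^sup>2)
        = (d / sqrt 2)\<^sup>2 * (\<Sum>i<k. (simplex_vertex k j i - simplex_vertex k l i)\<^sup>2)"
      by (simp only: v_def sum_distrib_left right_diff_distrib[symmetric] power_mult_distrib)
    also have "\<dots> = d\<^sup>2"
      using simplex_vertex_sum_squares[OF that False] by (simp add: power_divide)
    finally show ?thesis
      using False assms by (simp add: Rn_dist_def)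
  qed
qed

theorem corollary12:
  fixes m :: "'a::{boolean_algebra,finite} \<Rightarrow> real" and k :: nat
  assumes "card (atoms :: 'a set) = k + 1"
    and "fin_add_prob m"
    and "\<And>a. a \<in> atoms \<Longrightarrow> m a = 1 / (real k + 1)"
  shows "\<exists>f. isometric_embedding atoms (meas_dist m) (Rn k) (Rn_dist k) f"
proof -
  obtain h where h: "bij_betw h (atoms :: 'a set) {0..<k + 1}"
    using ex_bij_betw_finite_nat[of "atoms :: 'a set"] assms(1) by auto
  obtain v where v: "\<And>j. v j \<in> Rn k"
    and v_dist: "\<And>j l. j \<le> k \<Longrightarrow> l \<le> k \<Longrightarrow>
      Rn_dist k (v j) (v l) = (if j = l then 0 else 2 / (real k + 1))"
    by (rule regular_simplex_exists[of "2 / (real k + 1)" k]) auto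
  have "Rn_dist k (v (h a)) (v (h b)) = meas_dist m a b" if "a \<in> atoms" "b \<in> atoms" for a b
  proof -
    have "h a \<le> k" "h b \<le> k"
      using bij_betwE[OF h] that by fastforce+
    moreover have "h a = h b \<longleftrightarrow> a = b"
      using h that by (auto simp: bij_betw_def inj_on_eq_iff)
    ultimately have "Rn_dist k (v (h a)) (v (h b)) = (if a = b then 0 else 2 / (real k + 1))"
      using v_dist by simp
    also have "\<dots> = meas_dist m a b"
      using that assms(2,3) by (simp add: meas_dist_self meas_dist_disjoint atoms_disjoint)
    finally show ?thesis .
  qed
  with v have "isometric_embedding atoms (meas_dist m) (Rn k) (Rn_dist k) (\<lambda>a. v (h a))"
    by (simp add: isometric_embedding_def)
  then show ?thesis
    by (rule exI[where x = "\<lambda>a. v (h a)"])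
qed

end
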